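(* Let $X$ be a compact metric space and $(f_n)_{n\ge1}$ a sequence of continuous maps $X\to X$ converging uniformly to a function $\phi\colon X\to X$. Then $\phi^q\circ f_1^p=f_1^{p+q}$ for every $p\in\mathbb{N}^*$ and every $q\in\beta(\mathbb{N})$. In particular, the Ellis semigroup $E(X,\phi)$ acts on $E(X,f_{1,\infty})^*$: $h\circ g\in E(X,f_{1,\infty})^*$ for all $h\in E(X,\phi)$ and $g\in E(X,f_{1,\infty})^*$.
   Context: $\mathbb{N}=\{1,2,\dots\}$, $\beta(\mathbb{N})$ the ultrafilters on $\mathbb{N}$ (principal ones identified with $n\in\mathbb{N}$), $\mathbb{N}^*$ the free ones. For $r\in\mathbb{N}^*$, $r\text{-}\lim_n x_n$ is the unique $y$ with $\{n:x_n\in V\}\in r$ for all neighbourhoods $V$ of $y$. $f_1^n=f_n\circ\cdots\circ f_1$, $f_1^r(x)=r\text{-}\lim_n f_1^n(x)$ for $r\in\mathbb{N}^*$, $E(X,f_{1,\infty})^*=\{f_1^r:r\in\mathbb{N}^*\}$. $\phi^n$ is the $n$-fold composition, $\phi^q(x)=q\text{-}\lim_n\phi^n(x)$ for $q\in\mathbb{N}^*$, and $E(X,\phi)$ is the closure of $\{\phi^n:n\in\mathbb{N}\}$ in $X^X$ (pointwise topology), which equals $\{\phi^q:q\in\beta(\mathbb{N})\}$. Addition on $\beta(\mathbb{N})$: $p+q=\{A:\{n:\{m:m+n\in A\}\in p\}\in q\}$. *)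

theory Defs
  imports "HOL-Analysis.Analysis"
begin

text \<open>Ultrafilters on \<open>\<nat> = {1,2,...}\<close>, represented as filters on type nat that
  contain the set of positive integers.  The principal ultrafilter at n is
  \<open>principal {n}\<close>.\<close>
definition betaN :: "nat filter set" where
  "betaN = {F. F \<noteq> bot \<and> (\<forall>P. eventually P F \<or> eventually (\<lambda>n. \<not> P n) F)
               \<and> eventually (\<lambda>n. n \<ge> 1) F}"

definition betaN_star :: "nat filter set" where
  "betaN_star = {F \<in> betaN. \<forall>n. eventually (\<lambda>m. m \<noteq> n) F}"

definition ultra_add :: "nat filter \<Rightarrow> nat filter \<Rightarrow> nat filter" where
  "ultra_add p q = Abs_filter (\<lambda>A. eventually (\<lambda>n. eventually (\<lambda>m. A (m + n)) p) q)"

primrec fcomp :: "(nat \<Rightarrow> 'a \<Rightarrow> 'a) \<Rightarrow> nat \<Rightarrow> 'a \<Rightarrow> 'a" where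
  "fcomp f 0 = id"
| "fcomp f (Suc n) = f (Suc n) \<circ> fcomp f n"

definition fpow :: "(nat \<Rightarrow> 'a::t2_space \<Rightarrow> 'a) \<Rightarrow> nat filter \<Rightarrow> 'a \<Rightarrow> 'a" where
  "fpow f r x = Lim r (\<lambda>n. fcomp f n x)"

definition phipow :: "('a::t2_space \<Rightarrow> 'a) \<Rightarrow> nat filter \<Rightarrow> 'a \<Rightarrow> 'a" where
  "phipow \<phi> q x = Lim q (\<lambda>n. (\<phi> ^^ n) x)"

text \<open>Ellis semigroup \<open>E(X,\<phi>)\<close>: closure of {\<phi>^n : n \<ge> 1} in X^X with the
  pointwise topology.  Maps X \<rightarrow> X are represented by functions whose values
  outside X are irrelevant.\<close>
definition ellis_phi :: "'a::metric_space set \<Rightarrow> ('a \<Rightarrow> 'a) \<Rightarrow> ('a \<Rightarrow> 'a) set" where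
  "ellis_phi X \<phi> = {h. (\<forall>x\<in>X. h x \<in> X) \<and>
     (\<forall>F e. finite F \<and> F \<subseteq> X \<and> e > 0 \<longrightarrow>
        (\<exists>n\<ge>1. \<forall>x\<in>F. dist (h x) ((\<phi> ^^ n) x) < e))}"

definition ellis_star :: "'a::metric_space set \<Rightarrow> (nat \<Rightarrow> 'a \<Rightarrow> 'a) \<Rightarrow> ('a \<Rightarrow> 'a) set" where
  "ellis_star X f = {g. \<exists>r\<in>betaN_star. \<forall>x\<in>X. g x = fpow f r x}"

end

theory Submission imports Defs begin

text \<open>Write \<open>f_{m+1}^{m+k} = f_{m+k} \<circ> \<dots> \<circ> f_{m+1}\<close>. Uniform convergence \<open>f_n \<rightarrow> \<phi>\<close> together with the
  uniform continuity of \<open>\<phi>\<close> on the compact space gives \<open>f_{m+1}^{m+k} \<rightarrow> \<phi>^k\<close> uniformly as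
  \<open>m \<rightarrow> \<infinity>\<close>. Since a free ultrafilter \<open>p\<close> lives near infinity,
  \<open>p-lim_m f_1^{m+k}(x) = p-lim_m f_{m+1}^{m+k}(f_1^m x) = \<phi>^k(f_1^p x)\<close>, and taking the \<open>q\<close>-limit
  in \<open>k\<close> computes the \<open>(p+q)\<close>-limit of \<open>f_1^n x\<close>. An element \<open>h\<close> of \<open>E(X,\<phi>)\<close> is \<open>\<phi>^q\<close> for any
  ultrafilter \<open>q\<close> refining the filter of sets \<open>{n. \<phi>^n is close to h on a finite set}\<close>,
  so \<open>h \<circ> f_1^p = f_1^{p+q}\<close>, and \<open>p + q\<close> is again free.\<close>

definition is_ultrafilter :: "'a filter \<Rightarrow> bool" where
  "is_ultrafilter F \<longleftrightarrow> F \<noteq> bot \<and> (\<forall>P. eventually P F \<or> eventually (\<lambda>x. \<not> P x) F)"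

lemma betaN_iff: "F \<in> betaN \<longleftrightarrow> is_ultrafilter F \<and> eventually (\<lambda>n. n \<ge> 1) F"
  by (auto simp: betaN_def is_ultrafilter_def)

lemma betaN_star_iff:
  "F \<in> betaN_star \<longleftrightarrow> F \<in> betaN \<and> (\<forall>n. eventually (\<lambda>m. m \<noteq> n) F)"
  by (simp add: betaN_star_def)

lemma maximal_proper_filter_is_ultrafilter:
  assumes "U \<noteq> bot" and max: "\<And>G. G \<noteq> bot \<Longrightarrow> G \<le> U \<Longrightarrow> G = U"
  shows "is_ultrafilter U"
  unfolding is_ultrafilter_def
proof (intro conjI allI disjCI)
  fix P assume "\<not> eventually (\<lambda>x. \<not> P x) U"
  then have "inf U (principal {x. P x}) \<noteq> bot"
    by (simp add: trivial_limit_def eventually_inf_principal)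
  then have "inf U (principal {x. P x}) = U"
    using max inf_le1 by blast
  moreover have "eventually P (inf U (principal {x. P x}))"
    by (simp add: eventually_inf_principal)
  ultimately show "eventually P U" by simp
qed (fact \<open>U \<noteq> bot\<close>)

lemma ex_maximal_proper_filter_le:
  fixes F :: "'a filter"
  assumes F: "F \<noteq> bot"
  shows "\<exists>U\<le>F. U \<noteq> bot \<and> (\<forall>G. G \<noteq> bot \<longrightarrow> G \<le> U \<longrightarrow> G = U)"
proof -
  let ?R = "{(b, a). a \<noteq> bot \<and> a \<le> b \<and> b \<le> F}"
  have field_R: "Field ?R = {G. G \<noteq> bot \<and> G \<le> F}"
    by (auto simp: Field_def bot_unique)
  have "\<exists>m\<in>Field ?R. \<forall>a\<in>Field ?R. (m, a) \<in> ?R \<longrightarrow> a = m"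
  proof (rule Zorns_po_lemma)
    show "Partial_order ?R"
      by (auto simp: partial_order_on_def preorder_on_def
          antisym_def refl_on_def trans_def Field_def bot_unique)
    show "\<exists>u\<in>Field ?R. \<forall>a\<in>C. (a, u) \<in> ?R" if C: "C \<in> Chains ?R" for C
    proof (simp add: field_R, intro exI conjI ballI)
      have Inf_C: "Inf C \<noteq> bot" "Inf C \<le> F" if "C \<noteq> {}"
      proof -
        from C that have "Inf C = bot \<longleftrightarrow> (\<exists>x\<in>C. x = bot)"
          unfolding trivial_limit_def by (intro eventually_Inf_base) (auto simp: Chains_def)
        with C show "Inf C \<noteq> bot"
          by (auto simp: Chains_def)
        from that obtain x where "x \<in> C" by auto
        with C show "Inf C \<le> F"
          by (auto intro!: Inf_lower2[of x] simp: Chains_def)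
      qed
      then have [simp]: "inf F (Inf C) = (if C = {} then F else Inf C)"
        using C by (auto simp add: inf_absorb2)
      from C show "inf F (Inf C) \<noteq> bot" "inf F (Inf C) \<le> F"
        by (simp_all add: F Inf_C)
      with C show "inf F (Inf C) \<le> x" "x \<le> F" if "x \<in> C" for x
        using that by (auto intro: Inf_lower simp: Chains_def)
    qed
  qed
  then show ?thesis
    unfolding field_R by auto
qed

lemma ex_ultrafilter_le: "F \<noteq> bot \<Longrightarrow> \<exists>U\<le>F. is_ultrafilter U"
  using ex_maximal_proper_filter_le maximal_proper_filter_is_ultrafilter by metis

lemma ultrafilter_tendsto_in_compact:
  fixes a :: "'b \<Rightarrow> 'a::topological_space"
  assumes "is_ultrafilter F" "compact X" "eventually (\<lambda>n. a n \<in> X) F"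
  shows "\<exists>l\<in>X. (a \<longlongrightarrow> l) F"
proof -
  have F: "F \<noteq> bot" "\<And>P. eventually P F \<or> eventually (\<lambda>n. \<not> P n) F"
    using assms(1) by (auto simp: is_ultrafilter_def)
  have "filtermap a F \<noteq> bot" "eventually (\<lambda>x. x \<in> X) (filtermap a F)"
    using F(1) assms(3) by (simp_all add: filtermap_bot_iff eventually_filtermap)
  then obtain l where l: "l \<in> X" "inf (nhds l) (filtermap a F) \<noteq> bot"
    using \<open>compact X\<close> unfolding compact_filter by blast
  have "(a \<longlongrightarrow> l) F"
  proof (rule topological_tendstoI)
    fix S assume "open S" "l \<in> S"
    show "eventually (\<lambda>n. a n \<in> S) F"
    proof (rule ccontr)
      assume "\<not> eventually (\<lambda>n. a n \<in> S) F"
      then have "eventually (\<lambda>x. x \<notin> S) (filtermap a F)"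
        using F(2)[of "\<lambda>n. a n \<in> S"] by (auto simp: eventually_filtermap)
      moreover have "eventually (\<lambda>x. x \<in> S) (nhds l)"
        using \<open>open S\<close> \<open>l \<in> S\<close> by (rule eventually_nhds_in_open)
      ultimately have "eventually (\<lambda>x. False) (inf (nhds l) (filtermap a F))"
        unfolding eventually_inf by blast
      with l(2) show False by (simp add: trivial_limit_def)
    qed
  qed
  with l show ?thesis by blast
qed

lemma ultrafilter_Lim_in_compact:
  fixes a :: "'b \<Rightarrow> 'a::t2_space"
  assumes "is_ultrafilter F" "compact X" "eventually (\<lambda>n. a n \<in> X) F"
  shows "Lim F a \<in> X" "(a \<longlongrightarrow> Lim F a) F"
proof -
  obtain l where "l \<in> X" "(a \<longlongrightarrow> l) F"
    using ultrafilter_tendsto_in_compact[OF assms] by blast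
  moreover have "F \<noteq> bot" using assms(1) by (simp add: is_ultrafilter_def)
  ultimately show "Lim F a \<in> X" "(a \<longlongrightarrow> Lim F a) F"
    by (simp_all add: tendsto_Lim)
qed

lemma free_filter_le_sequentially:
  assumes "\<forall>n. eventually (\<lambda>m. m \<noteq> n) F"
  shows "F \<le> sequentially"
proof (rule filter_leI)
  fix P assume "eventually P sequentially"
  then obtain N where N: "\<And>n. n \<ge> N \<Longrightarrow> P n" by (auto simp: eventually_sequentially)
  have "eventually (\<lambda>m. \<forall>k\<in>{..<N}. m \<noteq> k) F"
    using assms by (intro eventually_ball_finite) auto
  then show "eventually P F" by eventually_elim (metis N lessThan_iff not_le)
qed

lemma ultra_add_is_filter:
  fixes p q :: "nat filter"
  shows "is_filter (\<lambda>A. eventually (\<lambda>n. eventually (\<lambda>m. A (m + n)) p) q)"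
proof
  fix P Q :: "nat \<Rightarrow> bool"
  assume "\<forall>\<^sub>F n in q. \<forall>\<^sub>F m in p. P (m + n)" "\<forall>\<^sub>F n in q. \<forall>\<^sub>F m in p. Q (m + n)"
  then show "\<forall>\<^sub>F n in q. \<forall>\<^sub>F m in p. P (m + n) \<and> Q (m + n)"
    by eventually_elim (rule eventually_conj)
next
  fix P Q :: "nat \<Rightarrow> bool"
  assume "\<forall>x. P x \<longrightarrow> Q x" "\<forall>\<^sub>F n in q. \<forall>\<^sub>F m in p. P (m + n)"
  then show "\<forall>\<^sub>F n in q. \<forall>\<^sub>F m in p. Q (m + n)"
    by (auto elim!: eventually_mono)
qed simp

lemma eventually_ultra_add:
  "eventually P (ultra_add p q) \<longleftrightarrow> eventually (\<lambda>n. eventually (\<lambda>m. P (m + n)) p) q"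
  unfolding ultra_add_def by (rule eventually_Abs_filter[OF ultra_add_is_filter])

lemma is_ultrafilter_ultra_add:
  assumes p: "is_ultrafilter p" and q: "is_ultrafilter q"
  shows "is_ultrafilter (ultra_add p q)"
  unfolding is_ultrafilter_def
proof (intro conjI allI)
  show "ultra_add p q \<noteq> bot"
    using p q by (simp add: is_ultrafilter_def trivial_limit_def eventually_ultra_add)
  fix P
  have p_split: "eventually (\<lambda>m. P (m + n)) p \<or> eventually (\<lambda>m. \<not> P (m + n)) p" for n
    using p by (simp add: is_ultrafilter_def)
  have "eventually (\<lambda>n. eventually (\<lambda>m. P (m + n)) p) q
      \<or> eventually (\<lambda>n. \<not> eventually (\<lambda>m. P (m + n)) p) q"
    using q by (simp add: is_ultrafilter_def)
  moreover have "eventually (\<lambda>n. eventually (\<lambda>m. \<not> P (m + n)) p) q"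
    if "eventually (\<lambda>n. \<not> eventually (\<lambda>m. P (m + n)) p) q"
    using that by (rule eventually_mono) (use p_split in blast)
  ultimately have "eventually (\<lambda>n. eventually (\<lambda>m. P (m + n)) p) q
      \<or> eventually (\<lambda>n. eventually (\<lambda>m. \<not> P (m + n)) p) q"
    by blast
  then show "eventually P (ultra_add p q) \<or> eventually (\<lambda>n. \<not> P n) (ultra_add p q)"
    by (simp add: eventually_ultra_add)
qed

lemma ultra_add_in_betaN_star:
  assumes p: "p \<in> betaN_star" and q: "q \<in> betaN"
  shows "ultra_add p q \<in> betaN_star"
proof -
  have p1: "eventually (\<lambda>m. m \<ge> 1) p" and free: "\<forall>k. eventually (\<lambda>m. m \<noteq> k) p"
    using p by (auto simp: betaN_star_iff betaN_iff)
  have "eventually (\<lambda>m. m + n \<noteq> k) p" for n k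
    using free[rule_format, of "k - n"] by (cases "n \<le> k") (auto elim: eventually_mono)
  moreover have "eventually (\<lambda>m. m + n \<ge> 1) p" for n
    using p1 by (auto elim: eventually_mono)
  ultimately show ?thesis
    using p q by (auto simp: betaN_star_iff betaN_iff eventually_ultra_add is_ultrafilter_ultra_add)
qed

lemma tendsto_ultra_add:
  assumes "\<And>n. ((\<lambda>m. a (m + n)) \<longlongrightarrow> b n) p" "(b \<longlongrightarrow> c) q"
  shows "(a \<longlongrightarrow> c) (ultra_add p q)"
proof (rule topological_tendstoI)
  fix S assume S: "open S" "c \<in> S"
  have "eventually (\<lambda>n. b n \<in> S) q"
    using assms(2) S by (rule topological_tendstoD)
  then show "eventually (\<lambda>k. a k \<in> S) (ultra_add p q)"
    unfolding eventually_ultra_add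
    by eventually_elim (rule topological_tendstoD[OF assms(1) \<open>open S\<close>])
qed

primrec fblock :: "(nat \<Rightarrow> 'a \<Rightarrow> 'a) \<Rightarrow> nat \<Rightarrow> nat \<Rightarrow> 'a \<Rightarrow> 'a" where
  "fblock f m 0 = id"
| "fblock f m (Suc k) = f (Suc (m + k)) \<circ> fblock f m k"

lemma fcomp_add: "fcomp f (m + k) = fblock f m k \<circ> fcomp f m"
  by (induction k) auto

lemma fcomp_image_subset:
  "(\<And>n. n \<ge> 1 \<Longrightarrow> f n ` X \<subseteq> X) \<Longrightarrow> fcomp f k ` X \<subseteq> X"
  by (induction k) auto

lemma fblock_image_subset:
  "(\<And>n. n \<ge> 1 \<Longrightarrow> f n ` X \<subseteq> X) \<Longrightarrow> fblock f m k ` X \<subseteq> X"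
  by (induction k) auto

lemma funpow_image_subset: "\<phi> ` X \<subseteq> X \<Longrightarrow> (\<phi> ^^ k) ` X \<subseteq> X"
  by (induction k) auto

lemma continuous_on_funpow:
  assumes "\<phi> ` X \<subseteq> X" "continuous_on X \<phi>"
  shows "continuous_on X (\<phi> ^^ k)"
proof (induction k)
  case (Suc k)
  have "continuous_on X (\<phi> \<circ> (\<phi> ^^ k))"
    using continuous_on_subset[OF assms(2) funpow_image_subset[OF assms(1)]]
    by (rule continuous_on_compose[OF Suc.IH])
  then show ?case by simp
qed (simp add: continuous_on_id)

lemma uniform_limit_compose_uniform_limit:
  fixes g :: "'i \<Rightarrow> 'a \<Rightarrow> 'b::metric_space" and h :: "'i \<Rightarrow> 'b \<Rightarrow> 'c::metric_space"
  assumes h: "uniform_limit Y h H F" and H: "uniformly_continuous_on Y H"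
    and g: "uniform_limit X g G F" "eventually (\<lambda>i. g i ` X \<subseteq> Y) F" and G: "G ` X \<subseteq> Y"
  shows "uniform_limit X (\<lambda>i x. h i (g i x)) (\<lambda>x. H (G x)) F"
proof (rule uniform_limitI)
  fix e :: real assume e: "e > 0"
  have "uniform_limit X (\<lambda>i x. H (g i x)) (H \<circ> G) F"
    using g G by (rule uniform_limit_compose[OF _ H])
  then have "eventually (\<lambda>i. \<forall>x\<in>X. dist (H (g i x)) (H (G x)) < e/2) F"
    using uniform_limitD[OF _ half_gt_zero[OF e]] by (simp add: o_def)
  moreover have "eventually (\<lambda>i. \<forall>y\<in>Y. dist (h i y) (H y) < e/2) F"
    using uniform_limitD[OF h half_gt_zero[OF e]] .
  ultimately show "eventually (\<lambda>i. \<forall>x\<in>X. dist (h i (g i x)) (H (G x)) < e) F"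
    using g(2)
  proof eventually_elim
    case (elim i)
    show ?case
    proof
      fix x assume "x \<in> X"
      have "dist (h i (g i x)) (H (G x)) \<le> dist (h i (g i x)) (H (g i x)) + dist (H (g i x)) (H (G x))"
        by (rule dist_triangle)
      also have "\<dots> < e/2 + e/2"
        using elim \<open>x \<in> X\<close> by (intro add_strict_mono) auto
      finally show "dist (h i (g i x)) (H (G x)) < e" by simp
    qed
  qed
qed

lemma uniform_limit_fblock:
  fixes f :: "nat \<Rightarrow> 'a::metric_space \<Rightarrow> 'a"
  assumes f_X: "\<And>n. n \<ge> 1 \<Longrightarrow> f n ` X \<subseteq> X" and \<phi>_X: "\<phi> ` X \<subseteq> X"
    and uc: "uniformly_continuous_on X \<phi>" and ul: "uniform_limit X f \<phi> sequentially"
  shows "uniform_limit X (\<lambda>m. fblock f m k) (\<phi> ^^ k) sequentially"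
proof (induction k)
  case (Suc k)
  have shifted: "uniform_limit X (\<lambda>m. f (Suc (m + k))) \<phi> sequentially"
    using ul by (rule filterlim_compose) (simp add: filterlim_subseq strict_mono_def)
  have "eventually (\<lambda>m. fblock f m k ` X \<subseteq> X) sequentially"
    using fblock_image_subset[of f X, OF f_X] by simp
  with shifted uc Suc.IH
  have "uniform_limit X (\<lambda>m x. f (Suc (m + k)) (fblock f m k x)) (\<lambda>x. \<phi> ((\<phi> ^^ k) x)) sequentially"
    using funpow_image_subset[OF \<phi>_X] by (rule uniform_limit_compose_uniform_limit)
  then show ?case by simp
qed (simp add: uniform_limit_iff)

lemma fpow_in:
  assumes "is_ultrafilter p" "compact X" "\<And>n. n \<ge> 1 \<Longrightarrow> f n ` X \<subseteq> X" "x \<in> X"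
  shows "fpow f p x \<in> X"
  unfolding fpow_def using assms(4) fcomp_image_subset[of f X, OF assms(3)]
  by (intro ultrafilter_Lim_in_compact[OF assms(1,2)] always_eventually) blast

lemma phipow_fpow:
  fixes X :: "'a::metric_space set"
  assumes X: "compact X" and f_X: "\<And>n. n \<ge> 1 \<Longrightarrow> f n ` X \<subseteq> X" and \<phi>_X: "\<phi> ` X \<subseteq> X"
    and cont: "continuous_on X \<phi>" and ul: "uniform_limit X f \<phi> sequentially"
    and p: "is_ultrafilter p" "\<forall>n. eventually (\<lambda>m. m \<noteq> n) p"
    and q: "is_ultrafilter q" and x: "x \<in> X"
  shows "phipow \<phi> q (fpow f p x) = fpow f (ultra_add p q) x"
proof -
  define z where "z = fpow f p x"
  have orbit_X: "eventually (\<lambda>m. fcomp f m x \<in> X) p"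
    using fcomp_image_subset[of f X, OF f_X] x by (intro always_eventually) blast
  have z: "z \<in> X" "((\<lambda>m. fcomp f m x) \<longlongrightarrow> z) p"
    unfolding z_def fpow_def by (fact ultrafilter_Lim_in_compact[OF p(1) X orbit_X])+
  have "((\<lambda>m. fcomp f (m + n) x) \<longlongrightarrow> (\<phi> ^^ n) z) p" for n
  proof -
    have "uniform_limit X (\<lambda>m. fblock f m n) (\<phi> ^^ n) sequentially"
      using f_X \<phi>_X compact_uniformly_continuous[OF cont X] ul by (rule uniform_limit_fblock)
    then have "uniform_limit X (\<lambda>m. fblock f m n) (\<phi> ^^ n) p"
      using order_refl free_filter_le_sequentially[OF p(2)] by (rule filterlim_mono)
    moreover have "uniformly_continuous_on X (\<phi> ^^ n)"
      using continuous_on_funpow[OF \<phi>_X cont] X by (rule compact_uniformly_continuous)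
    moreover have "uniform_limit {z} (\<lambda>m _. fcomp f m x) (\<lambda>_. z) p"
      using z(2) by simp
    ultimately have "uniform_limit {z} (\<lambda>m _. fblock f m n (fcomp f m x)) (\<lambda>_. (\<phi> ^^ n) z) p"
      by (rule uniform_limit_compose_uniform_limit) (use orbit_X z(1) in simp_all)
    then show ?thesis by (simp add: fcomp_add)
  qed
  moreover have "((\<lambda>n. (\<phi> ^^ n) z) \<longlongrightarrow> phipow \<phi> q z) q"
    unfolding phipow_def
    using funpow_image_subset[OF \<phi>_X] z(1)
    by (intro ultrafilter_Lim_in_compact[OF q X] always_eventually) blast
  ultimately have "((\<lambda>n. fcomp f n x) \<longlongrightarrow> phipow \<phi> q z) (ultra_add p q)"
    by (rule tendsto_ultra_add)
  moreover have "ultra_add p q \<noteq> bot"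
    using is_ultrafilter_ultra_add[OF p(1) q] by (simp add: is_ultrafilter_def)
  ultimately show ?thesis
    unfolding z_def fpow_def[of f "ultra_add p q"] by (simp add: tendsto_Lim)
qed

lemma ellis_phi_imp_phipow:
  assumes h: "h \<in> ellis_phi X \<phi>"
  shows "\<exists>q\<in>betaN. \<forall>x\<in>X. h x = phipow \<phi> q x"
proof -
  define I where "I = {(S, e). finite S \<and> S \<subseteq> X \<and> (e::real) > 0}"
  define N where "N = (\<lambda>(S, e). {n. n \<ge> 1 \<and> (\<forall>x\<in>S. dist (h x) ((\<phi> ^^ n) x) < e)})"
  define F where "F = (INF i\<in>I. principal (N i))"
  have "({}, 1) \<in> I" by (simp add: I_def)
  have F_base: "eventually P F \<longleftrightarrow> (\<exists>i\<in>I. eventually P (principal (N i)))" for P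
    unfolding F_def
  proof (rule eventually_INF_base)
    fix i j assume "i \<in> I" "j \<in> I"
    then show "\<exists>k\<in>I. principal (N k) \<le> inf (principal (N i)) (principal (N j))"
      by (intro bexI[of _ "(fst i \<union> fst j, min (snd i) (snd j))"]) (auto simp: I_def N_def)
  qed (use \<open>({}, 1) \<in> I\<close> in blast)
  have "F \<noteq> bot"
    using h by (auto simp: trivial_limit_def F_base I_def N_def ellis_phi_def eventually_principal)
  then obtain q where "q \<le> F" and q: "is_ultrafilter q"
    using ex_ultrafilter_le by blast
  have q_N: "eventually (\<lambda>n. n \<in> N i) q" if "i \<in> I" for i
    using order_trans[OF \<open>q \<le> F\<close>[unfolded F_def] INF_lower[OF that]] by (simp add: le_principal)
  have "eventually (\<lambda>n. n \<ge> 1) q"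
    using q_N[OF \<open>({}, 1) \<in> I\<close>] by (simp add: N_def)
  moreover have "h x = phipow \<phi> q x" if "x \<in> X" for x
  proof -
    have "((\<lambda>n. (\<phi> ^^ n) x) \<longlongrightarrow> h x) q"
    proof (rule tendstoI)
      fix e :: real assume "e > 0"
      with \<open>x \<in> X\<close> have "({x}, e) \<in> I" by (simp add: I_def)
      from q_N[OF this] show "eventually (\<lambda>n. dist ((\<phi> ^^ n) x) (h x) < e) q"
        by eventually_elim (simp add: N_def dist_commute)
    qed
    then show ?thesis
      using q by (simp add: phipow_def tendsto_Lim is_ultrafilter_def)
  qed
  ultimately show ?thesis
    using q by (auto simp: betaN_iff)
qed

theorem theorem3p9:
  fixes X :: "'a::metric_space set"
    and f :: "nat \<Rightarrow> 'a \<Rightarrow> 'a"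
    and \<phi> :: "'a \<Rightarrow> 'a"
  assumes "compact X"
    and "\<And>n. n \<ge> 1 \<Longrightarrow> continuous_on X (f n)"
    and "\<And>n. n \<ge> 1 \<Longrightarrow> f n ` X \<subseteq> X"
    and "\<phi> ` X \<subseteq> X"
    and "uniform_limit X f \<phi> sequentially"
  shows "(\<forall>p\<in>betaN_star. \<forall>q\<in>betaN. \<forall>x\<in>X.
            phipow \<phi> q (fpow f p x) = fpow f (ultra_add p q) x)
       \<and> (\<forall>h\<in>ellis_phi X \<phi>. \<forall>g\<in>ellis_star X f. h \<circ> g \<in> ellis_star X f)"
proof -
  have "continuous_on X \<phi>"
    using assms(2,5) by (intro uniform_limit_theorem) (auto simp: eventually_sequentially)
  then have comp: "phipow \<phi> q (fpow f p x) = fpow f (ultra_add p q) x"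
    if "p \<in> betaN_star" "q \<in> betaN" "x \<in> X" for p q x
    using that assms(1,3,4,5) by (intro phipow_fpow) (auto simp: betaN_star_iff betaN_iff)
  moreover have "h \<circ> g \<in> ellis_star X f" if "h \<in> ellis_phi X \<phi>" "g \<in> ellis_star X f" for h g
  proof -
    obtain p where p: "p \<in> betaN_star" and g: "\<And>x. x \<in> X \<Longrightarrow> g x = fpow f p x"
      using \<open>g \<in> ellis_star X f\<close> by (auto simp: ellis_star_def)
    obtain q where q: "q \<in> betaN" and h: "\<And>x. x \<in> X \<Longrightarrow> h x = phipow \<phi> q x"
      using ellis_phi_imp_phipow[OF \<open>h \<in> ellis_phi X \<phi>\<close>] by blast
    have "fpow f p x \<in> X" if "x \<in> X" for x
      using p that assms(1,3) by (intro fpow_in) (auto simp: betaN_star_iff betaN_iff)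
    then have "\<forall>x\<in>X. (h \<circ> g) x = fpow f (ultra_add p q) x"
      using comp[OF p q] g h by simp
    with ultra_add_in_betaN_star[OF p q] show ?thesis
      by (auto simp: ellis_star_def)
  qed
  ultimately show ?thesis by blast
qed

end
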